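(* Let $\mathbf{J}\sim\mathcal{N}(\mu,C)$ on $\mathbb{R}^d$, where $C$ is the squared exponential covariance function $$C\bigl(\tfrac{\|x-y\|^2}{2}\bigr)=\sigma^2\exp\Bigl(-\tfrac{\|x-y\|^2}{2s^2}\Bigr),\qquad \sigma^2>0,\ s>0.$$ Then for $w\in\mathbb{R}^d$ $$\eta^*\frac{\nabla\mathbf{J}(w)}{\|\nabla\mathbf{J}(w)\|}=\operatorname*{argmin}_{\mathbf{d}\in\mathbb{R}^d}\ \mathbb{E}[\mathbf{J}(w-\mathbf{d})\mid\mathbf{J}(w),\nabla\mathbf{J}(w)]$$ with RFD step size $$\eta^*=\frac{s^2\|\nabla\mathbf{J}(w)\|}{\sqrt{\bigl(\frac{\mu-\mathbf{J}(w)}{2}\bigr)^2+s^2\|\nabla\mathbf{J}(w)\|^2}+\frac{\mu-\mathbf{J}(w)}{2}}.$$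
   Context: $\mathbf{J}\sim\mathcal{N}(\mu,C)$ means that $\mathbf{J}$ is a Gaussian random function on $\mathbb{R}^d$ (with differentiable sample paths) with $\mathbb{E}[\mathbf{J}(w)]=\mu$ and $\operatorname{Cov}(\mathbf{J}(w),\mathbf{J}(\tilde w))=C\bigl(\tfrac{\|w-\tilde w\|^2}{2}\bigr)$. The point $w$ is deterministic and the statement is for $\nabla\mathbf{J}(w)\ne0$ (an almost sure event). *)

theory Defs
  imports "HOL-Probability.Probability"
begin

text \<open>A constant counts as Gaussian: \<open>s = 0\<close> is the degenerate case.\<close>

definition gaussian_rv :: "'w measure \<Rightarrow> ('w \<Rightarrow> real) \<Rightarrow> bool" where
  "gaussian_rv M X \<longleftrightarrow> X \<in> borel_measurable M \<and>
     (\<exists>m s. (s = 0 \<and> (AE \<omega> in M. X \<omega> = m)) \<or>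
            (s > 0 \<and> distributed M lborel X (\<lambda>x. ennreal (normal_density m s x))))"

text \<open>All finite-dimensional marginals are multivariate normal (possibly degenerate), i.e. every
  finite linear combination of values is univariate normal.\<close>

definition gaussian_process :: "'w measure \<Rightarrow> ('a \<Rightarrow> 'w \<Rightarrow> real) \<Rightarrow> bool" where
  "gaussian_process M J \<longleftrightarrow>
     (\<forall>A c. finite A \<longrightarrow> gaussian_rv M (\<lambda>\<omega>. \<Sum>x\<in>A. c x * J x \<omega>))"

definition covariance :: "'w measure \<Rightarrow> ('w \<Rightarrow> real) \<Rightarrow> ('w \<Rightarrow> real) \<Rightarrow> real" where
  "covariance M X Y =
     integral\<^sup>L M (\<lambda>\<omega>. (X \<omega> - integral\<^sup>L M X) * (Y \<omega> - integral\<^sup>L M Y))"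

text \<open>The isotropic law \<open>\<N>(\<mu>, C)\<close>; \<open>C\<close> is evaluated at half the squared distance.\<close>

definition isotropic_gaussian_function ::
    "'w measure \<Rightarrow> ('a::euclidean_space \<Rightarrow> 'w \<Rightarrow> real) \<Rightarrow> real \<Rightarrow> (real \<Rightarrow> real) \<Rightarrow> bool" where
  "isotropic_gaussian_function M J \<mu> C \<longleftrightarrow>
     prob_space M \<and>
     gaussian_process M J \<and>
     (\<forall>\<omega>\<in>space M. \<forall>x. (\<lambda>y. J y \<omega>) differentiable (at x)) \<and>
     (\<forall>x. integral\<^sup>L M (J x) = \<mu>) \<and>
     (\<forall>x y. covariance M (J x) (J y) = C ((norm (x - y))\<^sup>2 / 2))"

definition grad :: "('a::euclidean_space \<Rightarrow> real) \<Rightarrow> 'a \<Rightarrow> 'a" where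
  "grad f x = (THE g. GDERIV f x :> g)"

text \<open>The sigma-algebra generated by \<open>J(w)\<close> and \<open>\<nabla>J(w)\<close>.\<close>

definition value_grad_algebra ::
    "'w measure \<Rightarrow> ('a::euclidean_space \<Rightarrow> 'w \<Rightarrow> real) \<Rightarrow> 'a \<Rightarrow> 'w measure" where
  "value_grad_algebra M J w =
     vimage_algebra (space M) (\<lambda>\<omega>. (J w \<omega>, grad (\<lambda>x. J x \<omega>) w)) borel"

text \<open>For each fixed index \<open>d\<close> the conditional expectation is determined only up to a null set, so
  minimising it over uncountably many \<open>d\<close> needs one version for all \<open>d\<close> together. A version that is
  continuous in \<open>d\<close> is determined, for all \<open>d\<close> simultaneously, up to a single null set.\<close>

definition continuous_cond_exp_version ::
    "'w measure \<Rightarrow> 'w measure \<Rightarrow> ('a::euclidean_space \<Rightarrow> 'w \<Rightarrow> real) \<Rightarrow> ('a \<Rightarrow> 'w \<Rightarrow> real) \<Rightarrow> bool" where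
  "continuous_cond_exp_version M F X Z \<longleftrightarrow>
     (\<forall>d. Z d \<in> borel_measurable F \<and> (AE \<omega> in M. Z d \<omega> = real_cond_exp M F (X d) \<omega>)) \<and>
     (AE \<omega> in M. continuous_on UNIV (\<lambda>d. Z d \<omega>))"

definition argmin_set :: "('a \<Rightarrow> real) \<Rightarrow> 'a set" where
  "argmin_set f = {d. is_arg_min f (\<lambda>_. True) d}"

text \<open>The step size as a function of the observed value \<open>j\<close> and gradient \<open>g\<close>.\<close>

definition rfd_step_size :: "real \<Rightarrow> real \<Rightarrow> real \<Rightarrow> 'a::euclidean_space \<Rightarrow> real" where
  "rfd_step_size \<mu> s j g =
     s\<^sup>2 * norm g / (sqrt (((\<mu> - j) / 2)\<^sup>2 + s\<^sup>2 * (norm g)\<^sup>2) + (\<mu> - j) / 2)"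

end

theory Submission
  imports Defs
begin

text \<open>For a squared exponential covariance the conditional expectation has the closed form
  \<open>\<mu> + k(d) * (J(w) - \<mu> - d \<bullet> \<nabla>J(w))\<close> with \<open>k(d) = exp(-|d|\<^sup>2 / (2 s\<^sup>2))\<close>, and the theorem
  combines this formula with an elementary minimisation.

  The formula is Gaussian regression: the residual \<open>R\<close> of this predictor is centred, jointly Gaussian
  with the observation \<open>Y = (J(w), \<nabla>J(w))\<close> and uncorrelated with it, so it integrates to zero over every
  event determined by \<open>Y\<close>. Everything is read off characteristic functions. A
  directional derivative is a limit of difference quotients, so the joint characteristic function of
  \<open>J(w - d)\<close>, \<open>J(w)\<close> and \<open>\<beta> \<bullet> \<nabla>J(w)\<close> is the limit of those of combinations of three values of the
  field (\<open>joint_iexp\<close>); only the second-order Taylor expansion of \<open>k\<close> enters. For the residual it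
  factorises (\<open>residual_iexp\<close>), and differentiating in the coefficient of \<open>R\<close> at \<open>0\<close> gives
  \<open>E[R * exp(i u \<bullet> Y)] = 0\<close> for all \<open>u\<close> (\<open>residual_fourier\<close>). A weighted form of Levy's uniqueness
  theorem (\<open>fourier_uniqueness\<close>) turns this into \<open>E[R; Y \<in> S] = 0\<close> for all Borel sets \<open>S\<close>, which
  characterises the conditional expectation (\<open>predictor_cond_exp\<close>).

  The predictor is continuous in \<open>d\<close>, and any two continuous versions agree at all \<open>d\<close> outside one
  null set, because they agree on a countable dense set. So it is enough to minimise the predictor.
  With \<open>a = J(w) - \<mu>\<close>, \<open>g = \<nabla>J(w)\<close> and step size \<open>\<eta>\<close>, the first-order condition reads
  \<open>\<eta> * (\<eta> |g| - a) = s\<^sup>2 |g|\<close>, and then \<open>1 + x \<le> exp x\<close> together with Cauchy-Schwarz bounds the predictor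
  globally, with equality only at the claimed point (\<open>argmin_affine_times_gaussian\<close>). Almost surely
  \<open>g \<noteq> 0\<close>, since each directional derivative has a nondegenerate normal law.\<close>

section \<open>Fourier uniqueness for weighted random vectors\<close>

text \<open>The positive and the negative part of the weight have the same mass; after normalisation they give two
  laws of \<open>X\<close> with equal characteristic functions, so Levy's theorem applies.\<close>
lemma real_weight_fourier_uniqueness:
  fixes W X :: "'w \<Rightarrow> real"
  assumes W: "integrable M W" and X [measurable]: "X \<in> borel_measurable M"
    and F: "\<And>t. (CLINT \<omega>|M. of_real (W \<omega>) * iexp (t * X \<omega>)) = 0"
    and B: "B \<in> sets borel"
  shows "(LINT \<omega>|M. W \<omega> * indicator B (X \<omega>)) = 0"
proof -
  have [measurable]: "W \<in> borel_measurable M" using W by auto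
  define P where "P = (\<lambda>\<omega>. max 0 (W \<omega>))"
  define N where "N = (\<lambda>\<omega>. max 0 (- W \<omega>))"
  have iP: "integrable M P" and iN: "integrable M N"
    unfolding P_def N_def using W by auto
  have [measurable]: "P \<in> borel_measurable M" "N \<in> borel_measurable M" using iP iN by auto
  have WPN: "W \<omega> = P \<omega> - N \<omega>" and P0: "P \<omega> \<ge> 0" and N0: "N \<omega> \<ge> 0" for \<omega>
    unfolding P_def N_def by auto
  define c where "c = (LINT \<omega>|M. P \<omega>)"
  have "complex_of_real (LINT \<omega>|M. W \<omega>) = 0" using F[of 0] by simp
  then have "(LINT \<omega>|M. P \<omega> - N \<omega>) = 0" by (simp add: WPN)
  then have cN: "(LINT \<omega>|M. N \<omega>) = c" unfolding c_def using iP iN by simp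
  show ?thesis
  proof (cases "c = 0")
    case True
    then have "AE \<omega> in M. P \<omega> = 0" "AE \<omega> in M. N \<omega> = 0"
      using integral_nonneg_eq_0_iff_AE[THEN iffD1, OF iP] P0
        integral_nonneg_eq_0_iff_AE[THEN iffD1, OF iN] N0 cN
      by (simp_all add: c_def)
    then have "AE \<omega> in M. W \<omega> * indicator B (X \<omega>) = 0" by eventually_elim (simp add: WPN)
    then show ?thesis by (rule integral_eq_zero_AE)
  next
    case False
    have "c \<ge> 0" unfolding c_def by (rule Bochner_Integration.integral_nonneg) (rule P0)
    with False have c: "c > 0" by simp
    define D where "D = (\<lambda>V. distr (density M (\<lambda>\<omega>. ennreal (V \<omega> / c))) borel X)"
    have D: "real_distribution (D V)"
      if [measurable]: "V \<in> borel_measurable M"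
        and V: "integrable M V" "\<And>\<omega>. V \<omega> \<ge> 0" "(LINT \<omega>|M. V \<omega>) = c" for V
    proof -
      have "prob_space (density M (\<lambda>\<omega>. ennreal (V \<omega> / c)))"
        using V c by (intro prob_spaceI) (simp add: emeasure_density nn_integral_eq_integral)
      then show ?thesis unfolding D_def by (intro prob_space.real_distribution_distr) auto
    qed
    have ch: "char (D V) t = (CLINT \<omega>|M. of_real (V \<omega>) * iexp (t * X \<omega>)) / c"
      if [measurable]: "V \<in> borel_measurable M" and V: "\<And>\<omega>. V \<omega> \<ge> 0" for V t
    proof -
      have "char (D V) t = (CLINT \<omega>|M. (V \<omega> / c) *\<^sub>R iexp (t * X \<omega>))"
        unfolding char_def D_def using V c
        by (subst integral_distr; simp; subst integral_density; simp)
      then show ?thesis by (simp add: scaleR_conv_of_real)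
    qed
    have int: "integrable M (\<lambda>\<omega>. of_real (V \<omega>) * iexp (t * X \<omega>))" if "integrable M V" for V :: "'w \<Rightarrow> real" and t
      by (rule Bochner_Integration.integrable_bound[OF that]) (use that in \<open>auto simp: norm_mult\<close>)
    have "(CLINT \<omega>|M. of_real (P \<omega>) * iexp (t * X \<omega>)) = (CLINT \<omega>|M. of_real (N \<omega>) * iexp (t * X \<omega>))" for t
      using F[of t] int[OF iP, of t] int[OF iN, of t] by (simp add: WPN algebra_simps)
    then have "char (D P) = char (D N)" by (intro ext) (simp add: ch P0 N0)
    then have eq: "D P = D N"
      by (intro Levy_uniqueness D iP iN P0 N0 cN) (auto simp: c_def)
    have ms: "(LINT \<omega>|M. V \<omega> * indicator B (X \<omega>)) = c * (LINT x|D V. indicator B x)"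
      if [measurable]: "V \<in> borel_measurable M" and V: "\<And>\<omega>. V \<omega> \<ge> 0" for V
      unfolding D_def using V c B
      by (subst integral_distr; simp; subst integral_density; simp)
    have ib: "integrable M (\<lambda>\<omega>. V \<omega> * indicator B (X \<omega>))" if "integrable M V" for V :: "'w \<Rightarrow> real"
      by (rule Bochner_Integration.integrable_bound[OF that])
         (use that B in \<open>auto simp: indicator_def\<close>)
    have "(LINT \<omega>|M. W \<omega> * indicator B (X \<omega>)) =
        (LINT \<omega>|M. P \<omega> * indicator B (X \<omega>)) - (LINT \<omega>|M. N \<omega> * indicator B (X \<omega>))"
      using ib[OF iP] ib[OF iN] by (simp add: WPN algebra_simps)
    then show ?thesis by (simp add: ms P0 N0 eq)
  qed
qed

text \<open>Conjugating the hypothesis and replacing \<open>t\<close> by \<open>-t\<close> gives it for the conjugate weight, hence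
  for the real and the imaginary part. Complex weights arise because the factors
  \<open>exp(i u\<^sub>j Y\<^sub>j)\<close> of the other coordinates become part of the weight in the next lemma.\<close>
lemma complex_weight_fourier_uniqueness:
  fixes W :: "'w \<Rightarrow> complex" and X :: "'w \<Rightarrow> real"
  assumes W: "integrable M W" and X [measurable]: "X \<in> borel_measurable M"
    and F: "\<And>t. (CLINT \<omega>|M. W \<omega> * iexp (t * X \<omega>)) = 0"
    and B: "B \<in> sets borel"
  shows "(CLINT \<omega>|M. W \<omega> * indicator B (X \<omega>)) = 0"
proof -
  have [measurable]: "W \<in> borel_measurable M" using W by auto
  have int: "integrable M (\<lambda>\<omega>. W \<omega> * iexp (t * X \<omega>))" for t
    by (rule Bochner_Integration.integrable_bound[OF W]) (auto simp: norm_mult)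
  have "integrable M (\<lambda>\<omega>. cnj (W \<omega>))" using W by simp
  from borel_measurable_integrable[OF this]
  have [measurable]: "(\<lambda>\<omega>. cnj (W \<omega>)) \<in> borel_measurable M" .
  have int': "integrable M (\<lambda>\<omega>. cnj (W \<omega>) * iexp (t * X \<omega>))" for t
    by (rule Bochner_Integration.integrable_bound[OF W]) (auto simp: norm_mult)
  have F': "(CLINT \<omega>|M. cnj (W \<omega>) * iexp (t * X \<omega>)) = 0" for t
  proof -
    have "(CLINT \<omega>|M. cnj (W \<omega>) * iexp (t * X \<omega>)) = (CLINT \<omega>|M. cnj (W \<omega> * iexp ((- t) * X \<omega>)))"
      by (simp add: exp_cnj)
    also have "\<dots> = cnj (CLINT \<omega>|M. W \<omega> * iexp ((- t) * X \<omega>))" by (rule Bochner_Integration.integral_cnj)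
    finally show ?thesis using F[of "- t"] by simp
  qed
  have re: "complex_of_real (Re z) = (z + cnj z) / 2" for z by (simp add: complex_add_cnj)
  have im: "complex_of_real (Im z) = (z - cnj z) / (2 * \<i>)" for z by (simp add: complex_eq_iff)
  have "(CLINT \<omega>|M. of_real (Re (W \<omega>)) * iexp (t * X \<omega>)) = 0" for t
  proof -
    have "(CLINT \<omega>|M. of_real (Re (W \<omega>)) * iexp (t * X \<omega>)) =
       (CLINT \<omega>|M. (W \<omega> * iexp (t * X \<omega>) + cnj (W \<omega>) * iexp (t * X \<omega>)) / 2)"
      unfolding re by (simp add: algebra_simps)
    then show ?thesis using int[of t] int'[of t] F[of t] F'[of t] by simp
  qed
  then have R: "(LINT \<omega>|M. Re (W \<omega>) * indicator B (X \<omega>)) = 0"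
    using W by (intro real_weight_fourier_uniqueness B X) auto
  have "(CLINT \<omega>|M. of_real (Im (W \<omega>)) * iexp (t * X \<omega>)) = 0" for t
  proof -
    have "(CLINT \<omega>|M. of_real (Im (W \<omega>)) * iexp (t * X \<omega>)) =
       (CLINT \<omega>|M. (W \<omega> * iexp (t * X \<omega>) - cnj (W \<omega>) * iexp (t * X \<omega>)) / (2 * \<i>))"
      unfolding im by (simp add: algebra_simps diff_divide_distrib)
    then show ?thesis using int[of t] int'[of t] F[of t] F'[of t] by simp
  qed
  then have I: "(LINT \<omega>|M. Im (W \<omega>) * indicator B (X \<omega>)) = 0"
    using W by (intro real_weight_fourier_uniqueness B X) auto
  have "integrable M (\<lambda>\<omega>. W \<omega> * indicator B (X \<omega>))"
    by (rule Bochner_Integration.integrable_bound[OF W])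
       (use B in \<open>auto simp: norm_mult indicator_def\<close>)
  note ib = this
  have ri: "Re (W \<omega> * indicator B (X \<omega>)) = Re (W \<omega>) * indicator B (X \<omega>)"
     "Im (W \<omega> * indicator B (X \<omega>)) = Im (W \<omega>) * indicator B (X \<omega>)" for \<omega>
    by (auto simp: indicator_def)
  show ?thesis
    using integral_Re[OF ib] integral_Im[OF ib] R I unfolding ri by (simp add: complex_eq_iff)
qed

text \<open>Uniqueness on the real line suffices, since the coordinates are treated one at a time. Once the
  coordinates in \<open>S\<close> have been turned from exponentials into interval indicators, everything but the
  factor of the next coordinate \<open>j\<close> is a complex weight.\<close>
lemma fourier_uniqueness_boxes:
  fixes W :: "'w \<Rightarrow> real" and Y :: "'w \<Rightarrow> 'b::euclidean_space"
  assumes W: "integrable M W" and Y [measurable]: "Y \<in> borel_measurable M"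
    and F: "\<And>u. (CLINT \<omega>|M. of_real (W \<omega>) * iexp (u \<bullet> Y \<omega>)) = 0"
  shows "(LINT \<omega>|M. W \<omega> * indicator (box a b) (Y \<omega>)) = 0"
proof -
  have [measurable]: "W \<in> borel_measurable M" using W by auto
  define I where "I = (\<lambda>i \<omega>. indicator {a \<bullet> i <..< b \<bullet> i} (Y \<omega> \<bullet> i) :: complex)"
  have [measurable]: "I i \<in> borel_measurable M" for i unfolding I_def by measurable
  have nI: "norm (I i \<omega>) \<le> 1" for i \<omega> by (auto simp: I_def indicator_def)
  have "(CLINT \<omega>|M. of_real (W \<omega>) * (\<Prod>i\<in>S. I i \<omega>) * iexp (\<Sum>i\<in>Basis - S. u i * (Y \<omega> \<bullet> i))) = 0"
    if "finite S" "S \<subseteq> Basis" for S and u :: "'b \<Rightarrow> real"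
    using that
  proof (induction S arbitrary: u rule: finite_induct)
    case empty
    define v where "v = (\<Sum>i\<in>Basis. u i *\<^sub>R i)"
    have "v \<bullet> Y \<omega> = (\<Sum>i\<in>Basis. u i * (Y \<omega> \<bullet> i))" for \<omega>
      unfolding v_def inner_sum_left by (simp add: inner_commute[of "Y \<omega>"])
    then show ?case using F[of v] by simp
  next
    case (insert j S)
    define V where "V = (\<lambda>\<omega>. of_real (W \<omega>) * (\<Prod>i\<in>S. I i \<omega>) *
       iexp (\<Sum>i\<in>Basis - insert j S. u i * (Y \<omega> \<bullet> i)))"
    have "integrable M V"
    proof (rule Bochner_Integration.integrable_bound[OF W])
      show "V \<in> borel_measurable M" unfolding V_def by measurable
      have "norm (\<Prod>i\<in>S. I i \<omega>) \<le> 1" for \<omega>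
        unfolding prod_norm[symmetric] by (rule prod_le_1) (simp add: nI)
      then show "AE \<omega> in M. norm (V \<omega>) \<le> norm (W \<omega>)"
        by (auto simp: V_def norm_mult mult_left_le)
    qed
    moreover have "(CLINT \<omega>|M. V \<omega> * iexp (t * (Y \<omega> \<bullet> j))) = 0" for t
    proof -
      have "Basis - S = insert j (Basis - insert j S)" using insert by auto
      from arg_cong[OF this] have "(\<Sum>i\<in>Basis - S. (u(j := t)) i * (Y \<omega> \<bullet> i)) =
          t * (Y \<omega> \<bullet> j) + (\<Sum>i\<in>Basis - insert j S. (u(j := t)) i * (Y \<omega> \<bullet> i))" for \<omega>
        by (rule trans) simp
      moreover have "(\<Sum>i\<in>Basis - insert j S. (u(j := t)) i * (Y \<omega> \<bullet> i)) =
          (\<Sum>i\<in>Basis - insert j S. u i * (Y \<omega> \<bullet> i))" for \<omega>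
        by (rule sum.cong) auto
      ultimately have "V \<omega> * iexp (t * (Y \<omega> \<bullet> j)) =
          of_real (W \<omega>) * (\<Prod>i\<in>S. I i \<omega>) * iexp (\<Sum>i\<in>Basis - S. (u(j := t)) i * (Y \<omega> \<bullet> i))" for \<omega>
        by (simp add: V_def distrib_left exp_add mult_ac)
      then show ?thesis using insert.IH[of "u(j := t)"] insert.prems by simp
    qed
    ultimately have "(CLINT \<omega>|M. V \<omega> * indicator {a \<bullet> j <..< b \<bullet> j} (Y \<omega> \<bullet> j)) = 0"
      by (intro complex_weight_fourier_uniqueness) auto
    moreover have "V \<omega> * indicator {a \<bullet> j <..< b \<bullet> j} (Y \<omega> \<bullet> j) =
       of_real (W \<omega>) * (\<Prod>i\<in>insert j S. I i \<omega>) * iexp (\<Sum>i\<in>Basis - insert j S. u i * (Y \<omega> \<bullet> i))" for \<omega>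
      using insert.hyps by (simp add: V_def I_def mult_ac)
    ultimately show ?case by simp
  qed
  from this[of Basis "\<lambda>_. 0"]
  have "(CLINT \<omega>|M. of_real (W \<omega>) * (\<Prod>i\<in>Basis. I i \<omega>)) = 0" by simp
  moreover have "(\<Prod>i\<in>Basis. I i \<omega>) = of_real (indicator (box a b) (Y \<omega>))" for \<omega>
  proof (cases "Y \<omega> \<in> box a b")
    case True
    then show ?thesis by (auto simp: I_def box_def)
  next
    case False
    then obtain i where "i \<in> Basis" "I i \<omega> = 0" by (auto simp: box_def I_def)
    then have "(\<Prod>i\<in>Basis. I i \<omega>) = 0" by (intro prod_zero) auto
    then show ?thesis using False by simp
  qed
  ultimately have "complex_of_real (LINT \<omega>|M. W \<omega> * indicator (box a b) (Y \<omega>)) = 0"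
    by (simp flip: of_real_mult)
  then show ?thesis by simp
qed

text \<open>Boxes are an intersection-stable generator of the Borel sets, so Dynkin's theorem extends the
  previous lemma to all of them.\<close>
lemma fourier_uniqueness:
  fixes W :: "'w \<Rightarrow> real" and Y :: "'w \<Rightarrow> 'b::euclidean_space"
  assumes W: "integrable M W" and Y [measurable]: "Y \<in> borel_measurable M"
    and F: "\<And>u. (CLINT \<omega>|M. of_real (W \<omega>) * iexp (u \<bullet> Y \<omega>)) = 0"
    and S: "S \<in> sets borel"
  shows "(LINT \<omega>|M. W \<omega> * indicator S (Y \<omega>)) = 0"
proof -
  have [measurable]: "W \<in> borel_measurable M" using W by auto
  have ib: "integrable M (\<lambda>\<omega>. W \<omega> * indicator A (Y \<omega>))" if "A \<in> sets borel" for A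
    by (rule Bochner_Integration.integrable_bound[OF W])
       (use that in \<open>auto simp: indicator_def\<close>)
  have W0: "(LINT \<omega>|M. W \<omega>) = 0"
  proof -
    have "complex_of_real (LINT \<omega>|M. W \<omega>) = 0" using F[of 0] by simp
    then show ?thesis by simp
  qed
  have gen: "sets (borel :: 'b measure) = sigma_sets UNIV (range (\<lambda>(a, b). box a b))"
    by (subst borel_eq_box) simp
  have "Int_stable (range (\<lambda>(a::'b, b). box a b))"
    by (auto simp: Int_stable_def box_Int_box)
  moreover have "range (\<lambda>(a::'b, b). box a b) \<subseteq> Pow UNIV" by simp
  moreover have "S \<in> sigma_sets UNIV (range (\<lambda>(a, b). box a b))" using S gen by simp
  ultimately show ?thesis
  proof (induction S rule: sigma_sets_induct_disjoint[where \<Omega> = UNIV])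
    fix A :: "'b set" assume "A \<in> range (\<lambda>(a, b). box a b)"
    then show "(LINT \<omega>|M. W \<omega> * indicator A (Y \<omega>)) = 0"
      using fourier_uniqueness_boxes[OF W Y F] by auto
  next
    fix A :: "'b set"
    assume A: "A \<in> sigma_sets UNIV (range (\<lambda>(a, b). box a b))"
      and IH: "(LINT \<omega>|M. W \<omega> * indicator A (Y \<omega>)) = 0"
    have "(LINT \<omega>|M. W \<omega> * indicator (UNIV - A) (Y \<omega>)) =
        (LINT \<omega>|M. W \<omega> - W \<omega> * indicator A (Y \<omega>))"
      by (rule Bochner_Integration.integral_cong) (auto simp: indicator_def)
    also have "\<dots> = 0" using A W ib[of A] IH W0 by (simp add: gen)
    finally show "(LINT \<omega>|M. W \<omega> * indicator (UNIV - A) (Y \<omega>)) = 0" .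
  next
    fix A :: "nat \<Rightarrow> 'b set"
    assume dis: "disjoint_family A"
      and A: "range A \<subseteq> sigma_sets UNIV (range (\<lambda>(a, b). box a b))"
      and IH: "\<And>i. (LINT \<omega>|M. W \<omega> * indicator (A i) (Y \<omega>)) = 0"
    have A': "A i \<in> sets borel" for i using A by (auto simp: gen)
    define T where "T i = Y -` A i \<inter> space M" for i
    have T: "T i \<in> sets M" for i unfolding T_def by (rule measurable_sets[OF Y A'])
    have "(LINT \<omega>:(\<Union>i. T i)|M. W \<omega>) = (\<Sum>i. (LINT \<omega>:(T i)|M. W \<omega>))"
    proof (rule lebesgue_integral_countable_add[OF T])
      show "\<And>i j. i \<noteq> j \<Longrightarrow> T i \<inter> T j = {}"
        using dis by (auto simp: T_def disjoint_family_on_def)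
      show "set_integrable M (\<Union>i. T i) W"
        using W T unfolding set_integrable_def by (intro integrable_mult_indicator) auto
    qed
    moreover have "(LINT \<omega>:(T i)|M. W \<omega>) = (LINT \<omega>|M. W \<omega> * indicator (A i) (Y \<omega>))" for i
      unfolding set_lebesgue_integral_def T_def
      by (rule Bochner_Integration.integral_cong) (auto simp: indicator_def)
    moreover have "(LINT \<omega>:(\<Union>i. T i)|M. W \<omega>) = (LINT \<omega>|M. W \<omega> * indicator (\<Union>i. A i) (Y \<omega>))"
      unfolding set_lebesgue_integral_def T_def
      by (rule Bochner_Integration.integral_cong) (auto simp: indicator_def)
    ultimately show "(LINT \<omega>|M. W \<omega> * indicator (\<Union>i. A i) (Y \<omega>)) = 0" using IH by simp
  qed simp_all
qed

section \<open>Minimising an affine function times a Gaussian\<close>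

text \<open>With \<open>a = j - \<mu>\<close> and \<open>v = \<eta> |g| - a > 0\<close>, the step size satisfies \<open>|g| = v \<eta> / s\<^sup>2\<close>. Hence for
  \<open>t = |d|\<close>
  \<open>d \<bullet> g - a \<le> t |g| - a = v (1 + (t - \<eta>) \<eta> / s\<^sup>2) \<le> v exp((t - \<eta>) \<eta> / s\<^sup>2)\<close>,
  and completing the square leaves the factor \<open>exp(-(t - \<eta>)\<^sup>2 / (2 s\<^sup>2)) \<le> 1\<close>. Equality forces
  \<open>t = \<eta>\<close> and, by Cauchy-Schwarz, the direction of \<open>g\<close>. The bound holds
  for all \<open>d\<close> at once, so it gives existence of the minimiser on the unbounded domain as well.\<close>
lemma argmin_affine_times_gaussian:
  fixes g :: "'a::euclidean_space" and \<mu> s j :: real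
  assumes s: "s > 0" and g: "g \<noteq> 0"
  defines "\<eta> \<equiv> rfd_step_size \<mu> s j g"
  shows "argmin_set (\<lambda>d. \<mu> + exp (- ((norm d)\<^sup>2 / (2 * s\<^sup>2))) * (j - \<mu> - d \<bullet> g)) =
    {\<eta> *\<^sub>R (g /\<^sub>R norm g)}"
proof -
  define G where "G = norm g"
  have G: "G > 0" using g by (simp add: G_def)
  define a where "a = j - \<mu>"
  define q where "q = sqrt (((\<mu> - j) / 2)\<^sup>2 + s\<^sup>2 * G\<^sup>2)"
  have sG: "s\<^sup>2 * G\<^sup>2 > 0" using s G by simp
  have q2: "q\<^sup>2 = (a / 2)\<^sup>2 + s\<^sup>2 * G\<^sup>2"
    using sG by (simp add: q_def a_def power2_commute power_divide)
  have qa: "q > \<bar>a / 2\<bar>"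
  proof -
    have "sqrt ((a / 2)\<^sup>2) < q"
      unfolding q_def using sG
      by (intro real_sqrt_less_mono) (simp add: a_def power2_commute power_divide)
    then show ?thesis by simp
  qed
  have eta: "\<eta> = s\<^sup>2 * G / (q - a / 2)"
    unfolding \<eta>_def rfd_step_size_def q_def a_def G_def
    by (simp add: field_simps)
  have eta0: "\<eta> > 0" unfolding eta using s G qa by auto
  \<comment> \<open>Rationalising the denominator turns the stated step size into the positive root of
    \<open>\<eta>\<^sup>2 G - a \<eta> - s\<^sup>2 G = 0\<close>, the condition for a critical point along the gradient.\<close>
  have etaG: "\<eta> * G - a = q - a / 2"
  proof -
    have "s\<^sup>2 * G * G = (q - a / 2) * (q + a / 2)"
      using q2 by (simp add: power2_eq_square algebra_simps)
    moreover have "q - a / 2 \<noteq> 0" using qa by auto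
    ultimately show ?thesis unfolding eta by (simp add: field_simps)
  qed
  define v where "v = \<eta> * G - a"
  have v0: "v > 0" using etaG qa by (auto simp: v_def)
  have vG: "G = v * \<eta> / s\<^sup>2"
    using eta etaG v0 s by (simp add: v_def)
  define E where "E = (\<lambda>t::real. exp (- (t\<^sup>2 / (2 * s\<^sup>2))))"
  have expo: "E \<eta> * exp (- ((t - \<eta>)\<^sup>2 / (2 * s\<^sup>2))) = E t * exp ((t - \<eta>) * \<eta> / s\<^sup>2)" for t
    unfolding E_def exp_add[symmetric] using s
    by (simp add: power2_eq_square field_simps)
  have upper: "E (norm d) * (d \<bullet> g - a) \<le> E \<eta> * v" 
    and strict: "E (norm d) * (d \<bullet> g - a) = E \<eta> * v \<Longrightarrow> d = \<eta> *\<^sub>R (g /\<^sub>R norm g)" for d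
  proof -
    let ?t = "norm d"
    have 1: "E ?t * (d \<bullet> g - a) \<le> E ?t * (?t * G - a)"
      using norm_cauchy_schwarz[of d g] by (simp add: E_def G_def)
    have "?t * G - a = v * (1 + (?t - \<eta>) * \<eta> / s\<^sup>2)"
    proof -
      have "?t * G - a = v + (?t - \<eta>) * G" by (simp add: v_def algebra_simps)
      also have "\<dots> = v + (?t - \<eta>) * (v * \<eta> / s\<^sup>2)" using vG by simp
      finally show ?thesis by (simp add: algebra_simps)
    qed
    also have "\<dots> \<le> v * exp ((?t - \<eta>) * \<eta> / s\<^sup>2)"
      using v0 by (intro mult_left_mono exp_ge_add_one_self) auto
    finally have "E ?t * (?t * G - a) \<le> E ?t * (v * exp ((?t - \<eta>) * \<eta> / s\<^sup>2))"
      by (simp add: E_def)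
    also have "\<dots> = v * E \<eta> * exp (- ((?t - \<eta>)\<^sup>2 / (2 * s\<^sup>2)))" using expo[of ?t] by simp
    finally have 2: "E ?t * (?t * G - a) \<le> v * E \<eta> * exp (- ((?t - \<eta>)\<^sup>2 / (2 * s\<^sup>2)))" .
    have 3: "v * E \<eta> * exp (- ((?t - \<eta>)\<^sup>2 / (2 * s\<^sup>2))) \<le> E \<eta> * v"
      using v0 s by (simp add: E_def)
    show "E ?t * (d \<bullet> g - a) \<le> E \<eta> * v" using 1 2 3 by linarith
    assume eq: "E ?t * (d \<bullet> g - a) = E \<eta> * v"
    have "v * E \<eta> * exp (- ((?t - \<eta>)\<^sup>2 / (2 * s\<^sup>2))) = E \<eta> * v"
      using eq 1 2 3 by linarith
    then have t: "?t = \<eta>" using v0 s by (simp add: E_def)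
    have "E ?t * (d \<bullet> g - a) = E ?t * (?t * G - a)"
      using eq 1 2 3 by linarith
    then have "d \<bullet> g = norm d * norm g" by (simp add: E_def G_def)
    then have "norm d *\<^sub>R g = norm g *\<^sub>R d" by (simp add: norm_cauchy_schwarz_eq)
    then have "d = (1 / norm g) *\<^sub>R (norm d *\<^sub>R g)" using g by simp
    then show "d = \<eta> *\<^sub>R (g /\<^sub>R norm g)" using t by (simp add: field_simps)
  qed
  let ?d = "\<eta> *\<^sub>R (g /\<^sub>R norm g)"
  have nd: "norm ?d = \<eta>" using g eta0 by simp
  have "?d \<bullet> g = \<eta> * G"
    using g by (simp add: G_def dot_square_norm power2_eq_square)
  then have at: "E (norm ?d) * (?d \<bullet> g - a) = E \<eta> * v" unfolding nd by (simp add: v_def)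
  have obj: "\<mu> + exp (- ((norm d)\<^sup>2 / (2 * s\<^sup>2))) * (j - \<mu> - d \<bullet> g) = \<mu> - E (norm d) * (d \<bullet> g - a)" for d
    by (simp add: E_def a_def algebra_simps)
  have "(\<forall>y. \<mu> - E (norm d) * (d \<bullet> g - a) \<le> \<mu> - E (norm y) * (y \<bullet> g - a)) \<longleftrightarrow> d = ?d" for d
  proof
    assume "\<forall>y. \<mu> - E (norm d) * (d \<bullet> g - a) \<le> \<mu> - E (norm y) * (y \<bullet> g - a)"
    then have "E (norm ?d) * (?d \<bullet> g - a) \<le> E (norm d) * (d \<bullet> g - a)" 
      by (auto dest!: spec[of _ ?d])
    then have "E (norm d) * (d \<bullet> g - a) = E \<eta> * v" unfolding at using upper[of d] by linarith
    then show "d = ?d" by (rule strict)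
  next
    assume "d = ?d"
    then show "\<forall>y. \<mu> - E (norm d) * (d \<bullet> g - a) \<le> \<mu> - E (norm y) * (y \<bullet> g - a)"
      using at upper by (metis diff_left_mono)
  qed
  then show ?thesis unfolding argmin_set_def is_arg_min_linorder obj by simp
qed

section \<open>Characteristic functions of Gaussian variables\<close>

lemma (in prob_space) std_normal_iexp:
  assumes Z: "distributed M lborel Z std_normal_density"
  shows "(CLINT \<omega>|M. iexp (t * Z \<omega>)) = of_real (exp (- (t\<^sup>2) / 2))"
proof -
  have [measurable]: "Z \<in> borel_measurable M" using distributed_measurable[OF Z] by simp
  have "(CLINT \<omega>|M. iexp (t * Z \<omega>)) = char (distr M lborel Z) t"
    unfolding char_def by (subst integral_distr) auto
  also have "\<dots> = char std_normal_distribution t"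
    using distributed_distr_eq_density[OF Z] by simp
  finally show ?thesis by (simp add: char_std_normal_distribution)
qed

text \<open>Recovers the law of a directional derivative, for which only the characteristic function is
  computed below.\<close>
lemma (in prob_space) std_normal_of_iexp:
  assumes Z [measurable]: "Z \<in> borel_measurable M"
    and F: "\<And>t. (CLINT \<omega>|M. iexp (t * Z \<omega>)) = of_real (exp (- (t\<^sup>2) / 2))"
  shows "distributed M lborel Z std_normal_density"
proof -
  have "char (distr M borel Z) t = char std_normal_distribution t" for t
    unfolding char_std_normal_distribution
    by (subst F[symmetric]) (auto simp: char_def integral_distr)
  then have "distr M borel Z = std_normal_distribution"
    by (intro Levy_uniqueness real_dist_normal_dist real_distribution_distr) auto
  moreover have "distr M lborel Z = distr M borel Z" by (rule distr_cong) auto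
  ultimately show ?thesis by (simp add: distributed_def)
qed

lemma (in prob_space) gaussian_rv_square_integrable:
  assumes "gaussian_rv M X"
  shows "integrable M X" "integrable M (\<lambda>\<omega>. (X \<omega> - c)\<^sup>2)"
proof -
  from assms have [measurable]: "X \<in> borel_measurable M" by (simp add: gaussian_rv_def)
  have "integrable M X \<and> integrable M (\<lambda>\<omega>. (X \<omega>)\<^sup>2)"
  proof -
    from assms consider m where "AE \<omega> in M. X \<omega> = m"
      | m v where "v > 0" "distributed M lborel X (\<lambda>x. ennreal (normal_density m v x))"
      unfolding gaussian_rv_def by auto
    then show ?thesis
    proof cases
      case 1
      have "integrable M X = integrable M (\<lambda>_. m)"
        by (rule integrable_cong_AE) (use 1 in auto)
      moreover have "integrable M (\<lambda>\<omega>. (X \<omega>)\<^sup>2) = integrable M (\<lambda>_. m\<^sup>2)"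
        by (rule integrable_cong_AE) (use 1 in auto)
      ultimately show ?thesis by simp
    next
      case 2
      have 3: "integrable M (\<lambda>\<omega>. X \<omega> - m)"
        using distributed_integrable[OF 2(2), of "\<lambda>x. x - m"] integrable_normal_moment[OF 2(1), of m 1] by simp
      have 4: "integrable M (\<lambda>\<omega>. (X \<omega> - m)\<^sup>2)"
        using distributed_integrable[OF 2(2), of "\<lambda>x. (x - m)\<^sup>2"] integrable_normal_moment[OF 2(1), of m 2] by simp
      have "integrable M (\<lambda>\<omega>. (X \<omega> - m) + m)" using 3 by (intro Bochner_Integration.integrable_add) auto
      moreover have "integrable M (\<lambda>\<omega>. (X \<omega> - m)\<^sup>2 + 2 * m * (X \<omega> - m) + m\<^sup>2)"
        using 3 4 by (intro Bochner_Integration.integrable_add integrable_mult_right) auto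
      moreover have "(X \<omega> - m)\<^sup>2 + 2 * m * (X \<omega> - m) + m\<^sup>2 = (X \<omega>)\<^sup>2" for \<omega>
        by (simp add: power2_eq_square algebra_simps)
      ultimately show ?thesis by simp
    qed
  qed
  then have 5: "integrable M X" and 6: "integrable M (\<lambda>\<omega>. (X \<omega>)\<^sup>2)" by auto
  show "integrable M X" by (rule 5)
  have "integrable M (\<lambda>\<omega>. (X \<omega>)\<^sup>2 - 2 * c * X \<omega> + c\<^sup>2)"
    using 5 6 by (intro Bochner_Integration.integrable_add Bochner_Integration.integrable_diff integrable_mult_right) auto
  moreover have "(X \<omega>)\<^sup>2 - 2 * c * X \<omega> + c\<^sup>2 = (X \<omega> - c)\<^sup>2" for \<omega>
    by (simp add: power2_eq_square algebra_simps)
  ultimately show "integrable M (\<lambda>\<omega>. (X \<omega> - c)\<^sup>2)" by simp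
qed

lemma (in prob_space) gaussian_rv_iexp:
  assumes "gaussian_rv M X"
  shows "(CLINT \<omega>|M. iexp (X \<omega>)) = iexp (expectation X) * of_real (exp (- variance X / 2))"
proof -
  from assms have [measurable]: "X \<in> borel_measurable M" by (simp add: gaussian_rv_def)
  from assms consider m where "AE \<omega> in M. X \<omega> = m"
    | m v where "v > 0" "distributed M lborel X (\<lambda>x. ennreal (normal_density m v x))"
    unfolding gaussian_rv_def by auto
  then show ?thesis
  proof cases
    case 1
    have "expectation X = (LINT \<omega>|M. m)" by (rule integral_cong_AE) (use 1 in auto)
    then have E: "expectation X = m" by (simp add: prob_space)
    have "variance X = (LINT \<omega>|M. 0)" unfolding E by (rule integral_cong_AE) (use 1 in auto)
    moreover have "(CLINT \<omega>|M. iexp (X \<omega>)) = (CLINT \<omega>|M. iexp m)"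
      by (rule integral_cong_AE) (use 1 in auto)
    ultimately show ?thesis unfolding E by (simp add: prob_space)
  next
    case 2
    have E: "expectation X = m" by (rule normal_distributed_expectation[OF 2])
    have V: "variance X = v\<^sup>2" by (rule normal_distributed_variance[OF 2])
    have Z: "distributed M lborel (\<lambda>\<omega>. (X \<omega> - m) / v) std_normal_density"
      using normal_standard_normal_convert[OF 2(1)] 2(2) by simp
    have "iexp (X \<omega>) = iexp m * iexp (v * ((X \<omega> - m) / v))" for \<omega>
    proof -
      have "X \<omega> = m + v * ((X \<omega> - m) / v)" using 2(1) by simp
      then have "iexp (X \<omega>) = iexp (m + v * ((X \<omega> - m) / v))" by (rule arg_cong)
      then show ?thesis by (simp only: of_real_add distrib_left exp_add)
    qed
    then have "(CLINT \<omega>|M. iexp (X \<omega>)) = iexp m * (CLINT \<omega>|M. iexp (v * ((X \<omega> - m) / v)))"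
      by simp
    then show ?thesis unfolding std_normal_iexp[OF Z] E V[unfolded E] by simp
  qed
qed

section \<open>Gradients and difference quotients\<close>

lemma grad_has_derivative:
  fixes f :: "'a::euclidean_space \<Rightarrow> real"
  assumes "f differentiable (at x)"
  shows "(f has_derivative (\<lambda>h. h \<bullet> grad f x)) (at x)"
proof -
  from assms obtain f' where f': "(f has_derivative f') (at x)" by (auto simp: differentiable_def)
  then have lin: "linear f'" by (rule has_derivative_linear)
  define g where "g = (\<Sum>b\<in>Basis. f' b *\<^sub>R b)"
  have "f' h = h \<bullet> g" for h
  proof -
    have "f' h = f' (\<Sum>b\<in>Basis. (h \<bullet> b) *\<^sub>R b)" by (simp add: euclidean_representation)
    also have "\<dots> = (\<Sum>b\<in>Basis. (h \<bullet> b) * f' b)"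
      using lin by (simp add: linear_sum linear_scale)
    finally show ?thesis by (simp add: g_def inner_sum_right mult.commute)
  qed
  then have "f' = (\<lambda>h. h \<bullet> g)" by (rule ext)
  with f' have "GDERIV f x :> g" by (simp add: gderiv_def)
  moreover have "g' = g" if "GDERIV f x :> g'" for g'
  proof -
    have "(\<lambda>h. h \<bullet> g') = (\<lambda>h. h \<bullet> g)"
      using that \<open>GDERIV f x :> g\<close> unfolding gderiv_def by (rule has_derivative_unique)
    then have "(g' - g) \<bullet> g' = (g' - g) \<bullet> g" by meson
    then have "(g' - g) \<bullet> (g' - g) = 0" by (simp add: inner_diff_right)
    then show ?thesis by simp
  qed
  ultimately have "GDERIV f x :> grad f x" unfolding grad_def by (rule theI)
  then show ?thesis by (simp add: gderiv_def)
qed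

lemma difference_quotient_sequentially:
  fixes f :: "'a::real_normed_field \<Rightarrow> 'a"
  assumes f: "(f has_field_derivative l) (at 0)"
    and h: "h \<longlonglongrightarrow> 0" "\<And>n. h n \<noteq> 0"
  shows "(\<lambda>n. (f (h n) - f 0) / h n) \<longlonglongrightarrow> l"
proof -
  have "((\<lambda>y. (f y - f 0) / y) \<longlongrightarrow> l) (at 0)"
    using f by (simp add: has_field_derivative_iff)
  moreover have "filterlim h (at 0) sequentially"
    using h by (simp add: filterlim_at)
  ultimately show ?thesis by (rule filterlim_compose)
qed

section \<open>Taylor expansion of the squared exponential kernel\<close>

definition se_kernel :: "real \<Rightarrow> 'a::euclidean_space \<Rightarrow> real" where
  "se_kernel s v = exp (- ((norm v)\<^sup>2 / (2 * s\<^sup>2)))"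

lemma se_kernel_minus [simp]: "se_kernel s (- v) = se_kernel s v"
  by (simp add: se_kernel_def)

lemma se_kernel_0 [simp]: "se_kernel s 0 = 1"
  by (simp add: se_kernel_def)

lemma se_kernel_first_order:
  fixes d \<beta> :: "'a::euclidean_space"
  assumes s: "s > 0"
  shows "(\<lambda>n. real (Suc n) * (se_kernel s (d + \<beta> /\<^sub>R real (Suc n)) - se_kernel s d))
    \<longlonglongrightarrow> - (d \<bullet> \<beta>) * se_kernel s d / s\<^sup>2"
proof -
  define f where "f = (\<lambda>h::real. exp (- ((d \<bullet> d + 2 * (d \<bullet> \<beta>) * h + \<beta> \<bullet> \<beta> * h\<^sup>2) / (2 * s\<^sup>2))))"
  have k: "se_kernel s (d + h *\<^sub>R \<beta>) = f h" for h
    unfolding f_def se_kernel_def power2_norm_eq_inner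
    by (simp add: inner_add_left inner_add_right inner_commute power2_eq_square algebra_simps)
  have "(f has_field_derivative - (d \<bullet> \<beta>) * f 0 / s\<^sup>2) (at 0)"
    unfolding f_def using s by (auto intro!: derivative_eq_intros simp: field_simps)
  from difference_quotient_sequentially[OF this LIMSEQ_inverse_real_of_nat]
  have "(\<lambda>n. (f (inverse (real (Suc n))) - f 0) / inverse (real (Suc n))) \<longlonglongrightarrow> - (d \<bullet> \<beta>) * f 0 / s\<^sup>2"
    by simp
  then show ?thesis using k[of 0] by (simp flip: k add: field_simps)
qed

lemma se_kernel_second_order:
  fixes \<beta> :: "'a::euclidean_space"
  assumes s: "s > 0"
  shows "(\<lambda>n. (real (Suc n))\<^sup>2 * (se_kernel s (\<beta> /\<^sub>R real (Suc n)) - 1)) \<longlonglongrightarrow> - (norm \<beta>)\<^sup>2 / (2 * s\<^sup>2)"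
proof -
  define f where "f = (\<lambda>h::real. exp (- ((norm \<beta>)\<^sup>2 * h / (2 * s\<^sup>2))))"
  have k: "se_kernel s (h *\<^sub>R \<beta>) = f (h\<^sup>2)" for h
    unfolding f_def se_kernel_def by (simp add: power_mult_distrib mult.commute)
  have f: "(f has_field_derivative - (norm \<beta>)\<^sup>2 / (2 * s\<^sup>2)) (at 0)"
    unfolding f_def using s by (auto intro!: derivative_eq_intros simp: field_simps)
  have "(\<lambda>n. (inverse (real (Suc n)))\<^sup>2) \<longlonglongrightarrow> 0\<^sup>2"
    by (intro tendsto_power LIMSEQ_inverse_real_of_nat)
  then have "(\<lambda>n. (f ((inverse (real (Suc n)))\<^sup>2) - f 0) / (inverse (real (Suc n)))\<^sup>2)
      \<longlonglongrightarrow> - (norm \<beta>)\<^sup>2 / (2 * s\<^sup>2)"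
    by (intro difference_quotient_sequentially f) auto
  moreover have "f 0 = 1" by (simp add: f_def)
  moreover have "a / (inverse b)\<^sup>2 = b\<^sup>2 * a" for a b :: real by (simp add: divide_simps)
  ultimately show ?thesis unfolding k by (simp only:)
qed

text \<open>The left-hand side is, up to the factor \<open>\<sigma>\<^sup>2\<close>, the variance of
  \<open>t J(w - d) + \<alpha> J(w) + N (J(w + \<beta>/N) - J(w))\<close>. Its terms of order \<open>N\<^sup>2\<close> combine to
  \<open>2 N\<^sup>2 (1 - k(\<beta>/N))\<close>, the only place where the second-order expansion enters.\<close>
lemma increment_variance_limit:
  fixes d \<beta> :: "'a::euclidean_space"
  assumes s: "s > 0"
  defines "N \<equiv> \<lambda>n. real (Suc n)"
  shows "(\<lambda>n. t\<^sup>2 + (\<alpha> - N n)\<^sup>2 + (N n)\<^sup>2 + 2 * t * (\<alpha> - N n) * se_kernel s d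
      + 2 * t * N n * se_kernel s (d + \<beta> /\<^sub>R N n) + 2 * (\<alpha> - N n) * N n * se_kernel s (\<beta> /\<^sub>R N n))
    \<longlonglongrightarrow> t\<^sup>2 + \<alpha>\<^sup>2 + 2 * t * \<alpha> * se_kernel s d + (norm \<beta>)\<^sup>2 / s\<^sup>2
      - 2 * t * (d \<bullet> \<beta>) * se_kernel s d / s\<^sup>2"
proof -
  let ?c = "t\<^sup>2 + \<alpha>\<^sup>2 + 2 * t * \<alpha> * se_kernel s d"
  define D where "D n = N n * (se_kernel s (d + \<beta> /\<^sub>R N n) - se_kernel s d)" for n
  define E where "E n = N n * (se_kernel s (0 + \<beta> /\<^sub>R N n) - se_kernel s (0::'a))" for n
  define H where "H n = (N n)\<^sup>2 * (se_kernel s (\<beta> /\<^sub>R N n) - 1)" for n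
  have "D \<longlonglongrightarrow> - (d \<bullet> \<beta>) * se_kernel s d / s\<^sup>2"
    unfolding D_def N_def by (rule se_kernel_first_order[OF s])
  moreover have "E \<longlonglongrightarrow> - (0 \<bullet> \<beta>) * se_kernel s (0::'a) / s\<^sup>2"
    unfolding E_def N_def by (rule se_kernel_first_order[OF s])
  moreover have "H \<longlonglongrightarrow> - (norm \<beta>)\<^sup>2 / (2 * s\<^sup>2)"
    unfolding H_def N_def by (rule se_kernel_second_order[OF s])
  ultimately have "(\<lambda>n. ?c + 2 * t * D n + 2 * \<alpha> * E n - 2 * H n) \<longlonglongrightarrow>
      ?c + 2 * t * (- (d \<bullet> \<beta>) * se_kernel s d / s\<^sup>2)
      + 2 * \<alpha> * (- (0 \<bullet> \<beta>) * se_kernel s (0::'a) / s\<^sup>2) - 2 * (- (norm \<beta>)\<^sup>2 / (2 * s\<^sup>2))"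
    by (intro tendsto_diff[OF tendsto_add[OF tendsto_add]] tendsto_const tendsto_mult_left)
  moreover have "?c + 2 * t * D n + 2 * \<alpha> * E n - 2 * H n =
      t\<^sup>2 + (\<alpha> - N n)\<^sup>2 + (N n)\<^sup>2 + 2 * t * (\<alpha> - N n) * se_kernel s d
      + 2 * t * N n * se_kernel s (d + \<beta> /\<^sub>R N n) + 2 * (\<alpha> - N n) * N n * se_kernel s (\<beta> /\<^sub>R N n)" for n
    unfolding D_def E_def H_def add_0 se_kernel_0 by (simp add: algebra_simps power2_eq_square)
  moreover have "?c + 2 * t * (- (d \<bullet> \<beta>) * se_kernel s d / s\<^sup>2)
      + 2 * \<alpha> * (- (0 \<bullet> \<beta>) * se_kernel s (0::'a) / s\<^sup>2) - 2 * (- (norm \<beta>)\<^sup>2 / (2 * s\<^sup>2)) =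
      ?c + (norm \<beta>)\<^sup>2 / s\<^sup>2 - 2 * t * (d \<bullet> \<beta>) * se_kernel s d / s\<^sup>2"
    by simp
  ultimately show ?thesis by (simp only:)
qed

section \<open>The field and its gradient\<close>

locale se_gaussian_field = prob_space M
  for M :: "'w measure" +
  fixes J :: "'a::euclidean_space \<Rightarrow> 'w \<Rightarrow> real" and \<mu> \<sigma> s :: real
  assumes gaussian: "gaussian_process M J"
    and differentiable: "\<omega> \<in> space M \<Longrightarrow> (\<lambda>y. J y \<omega>) differentiable (at x)"
    and mean: "expectation (J x) = \<mu>"
    and cov: "covariance M (J x) (J y) = \<sigma>\<^sup>2 * se_kernel s (x - y)"
    and sigma: "\<sigma>\<^sup>2 > 0"
    and s: "s > 0"
begin

lemma gaussian_value: "gaussian_rv M (J x)"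
  using gaussian[unfolded gaussian_process_def, rule_format, of "{x}" "\<lambda>_. 1"] by simp

lemma J_measurable [measurable]: "J x \<in> borel_measurable M"
  using gaussian_value[of x] by (simp add: gaussian_rv_def)

lemma J_integrable: "integrable M (J x)"
  by (rule gaussian_rv_square_integrable[OF gaussian_value])

lemma J_product:
  "integrable M (\<lambda>\<omega>. (J x \<omega> - \<mu>) * (J y \<omega> - \<mu>))"
  "expectation (\<lambda>\<omega>. (J x \<omega> - \<mu>) * (J y \<omega> - \<mu>)) = \<sigma>\<^sup>2 * se_kernel s (x - y)"
proof -
  have "integrable M (\<lambda>\<omega>. (J x \<omega> - \<mu>)\<^sup>2 + (J y \<omega> - \<mu>)\<^sup>2)"
    by (intro Bochner_Integration.integrable_add gaussian_rv_square_integrable gaussian_value)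
  then show "integrable M (\<lambda>\<omega>. (J x \<omega> - \<mu>) * (J y \<omega> - \<mu>))"
  proof (rule Bochner_Integration.integrable_bound)
    have "\<bar>a * b\<bar> \<le> a\<^sup>2 + b\<^sup>2" for a b :: real
    proof -
      have "2 * \<bar>a * b\<bar> \<le> a\<^sup>2 + b\<^sup>2"
        using sum_squares_bound[of "\<bar>a\<bar>" "\<bar>b\<bar>"] by (simp add: abs_mult)
      then show ?thesis using abs_ge_zero[of "a * b"] by linarith
    qed
    then show "AE \<omega> in M. norm ((J x \<omega> - \<mu>) * (J y \<omega> - \<mu>)) \<le> norm ((J x \<omega> - \<mu>)\<^sup>2 + (J y \<omega> - \<mu>)\<^sup>2)"
      by (auto simp: real_norm_def)
  qed measurable
  show "expectation (\<lambda>\<omega>. (J x \<omega> - \<mu>) * (J y \<omega> - \<mu>)) = \<sigma>\<^sup>2 * se_kernel s (x - y)"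
    using cov[of x y] by (simp add: covariance_def mean)
qed

text \<open>Three values are enough for every later computation: \<open>J(w - d)\<close>, \<open>J(w)\<close> and the second point of
  one difference quotient, in whatever direction the derivative is taken.\<close>
lemma three_point_iexp:
  "(CLINT \<omega>|M. iexp (a * J p \<omega> + b * J q \<omega> + c * J r \<omega>)) =
    iexp (\<mu> * (a + b + c)) * of_real (exp (- (\<sigma>\<^sup>2 * (a\<^sup>2 + b\<^sup>2 + c\<^sup>2 + 2 * a * b * se_kernel s (p - q)
      + 2 * a * c * se_kernel s (p - r) + 2 * b * c * se_kernel s (q - r))) / 2))"
proof -
  define X where "X = (\<lambda>\<omega>. a * J p \<omega> + b * J q \<omega> + c * J r \<omega>)"
  define f where "f x = (if x = p then a else 0) + (if x = q then b else 0) + (if x = r then c else 0)" for x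
  \<comment> \<open>The three points may coincide, so their coefficients are accumulated in \<open>f\<close>.\<close>
  have "(\<Sum>x\<in>{p, q, r}. f x * J x \<omega>) = X \<omega>" for \<omega>
  proof -
    have "f x * J x \<omega> = (if x = p then a * J p \<omega> else 0) + (if x = q then b * J q \<omega> else 0)
        + (if x = r then c * J r \<omega> else 0)" for x
      by (simp add: f_def distrib_right)
    then show ?thesis by (simp only: sum.distrib) (simp add: X_def sum.delta)
  qed
  then have G: "gaussian_rv M X"
    using gaussian[unfolded gaussian_process_def, rule_format, of "{p, q, r}" f] by simp
  have E: "expectation X = \<mu> * (a + b + c)"
    unfolding X_def using J_integrable by (simp add: mean algebra_simps)
  let ?K = "\<lambda>x y \<omega>. (J x \<omega> - \<mu>) * (J y \<omega> - \<mu>)"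
  have "(X \<omega> - expectation X)\<^sup>2 = a\<^sup>2 * ?K p p \<omega> + b\<^sup>2 * ?K q q \<omega> + c\<^sup>2 * ?K r r \<omega>
      + (2 * a * b) * ?K p q \<omega> + (2 * a * c) * ?K p r \<omega> + (2 * b * c) * ?K q r \<omega>" for \<omega>
    unfolding E by (simp add: X_def power2_eq_square algebra_simps)
  then have "variance X = a\<^sup>2 * expectation (?K p p) + b\<^sup>2 * expectation (?K q q) + c\<^sup>2 * expectation (?K r r)
      + (2 * a * b) * expectation (?K p q) + (2 * a * c) * expectation (?K p r)
      + (2 * b * c) * expectation (?K q r)"
    using J_product(1) by simp
  then have "variance X = \<sigma>\<^sup>2 * (a\<^sup>2 + b\<^sup>2 + c\<^sup>2 + 2 * a * b * se_kernel s (p - q)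
      + 2 * a * c * se_kernel s (p - r) + 2 * b * c * se_kernel s (q - r))"
    unfolding J_product(2) by (simp add: algebra_simps)
  then show ?thesis using gaussian_rv_iexp[OF G] E by (simp add: X_def)
qed


definition field_grad :: "'a \<Rightarrow> 'w \<Rightarrow> 'a" where
  "field_grad w \<omega> = grad (\<lambda>x. J x \<omega>) w"

lemma increment_tendsto_field_grad:
  assumes "\<omega> \<in> space M"
  shows "(\<lambda>n. real (Suc n) * (J (w + \<beta> /\<^sub>R real (Suc n)) \<omega> - J w \<omega>)) \<longlonglongrightarrow> \<beta> \<bullet> field_grad w \<omega>"
proof -
  define f where "f h = J (w + h *\<^sub>R \<beta>) \<omega>" for h
  have "((\<lambda>x. J x \<omega>) has_derivative (\<lambda>h. h \<bullet> field_grad w \<omega>)) (at (w + 0 *\<^sub>R \<beta>))"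
    using grad_has_derivative[OF differentiable[OF assms]] by (simp add: field_grad_def)
  moreover have "((\<lambda>h::real. w + h *\<^sub>R \<beta>) has_derivative (\<lambda>h. h *\<^sub>R \<beta>)) (at 0)"
    by (auto intro!: derivative_eq_intros)
  ultimately have "(f has_derivative (\<lambda>h. (h *\<^sub>R \<beta>) \<bullet> field_grad w \<omega>)) (at 0)"
    unfolding f_def by (rule has_derivative_compose[rotated])
  then have "(f has_field_derivative \<beta> \<bullet> field_grad w \<omega>) (at 0)"
    by (simp add: has_field_derivative_def mult.commute[of _ "\<beta> \<bullet> field_grad w \<omega>"])
  then have "(\<lambda>n. (f (inverse (real (Suc n))) - f 0) / inverse (real (Suc n))) \<longlonglongrightarrow> \<beta> \<bullet> field_grad w \<omega>"
    by (rule difference_quotient_sequentially[OF _ LIMSEQ_inverse_real_of_nat]) simp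
  moreover have "a / inverse b = b * a" for a b :: real by (simp add: divide_simps)
  ultimately show ?thesis unfolding f_def by (simp only: scale_zero_left add_0_right)
qed

lemma inner_field_grad_measurable [measurable]: "(\<lambda>\<omega>. \<beta> \<bullet> field_grad w \<omega>) \<in> borel_measurable M"
  by (rule borel_measurable_LIMSEQ_real[OF increment_tendsto_field_grad]) measurable

lemma field_grad_measurable [measurable]: "field_grad w \<in> borel_measurable M"
proof (subst borel_measurable_euclidean_space, rule ballI)
  fix i :: 'a
  have "(\<lambda>\<omega>. field_grad w \<omega> \<bullet> i) = (\<lambda>\<omega>. i \<bullet> field_grad w \<omega>)" by (rule ext) (rule inner_commute)
  then show "(\<lambda>\<omega>. field_grad w \<omega> \<bullet> i) \<in> borel_measurable M" using inner_field_grad_measurable by simp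
qed

text \<open>The characteristic functions of the approximating combinations of three values converge by
  dominated convergence on one side and by \<open>increment_variance_limit\<close> on the other. The limit
  exhibits the covariances
  \<open>Cov(\<beta> \<bullet> \<nabla>J(w), J(w)) = 0\<close>, \<open>Var(\<beta> \<bullet> \<nabla>J(w)) = \<sigma>\<^sup>2 |\<beta>|\<^sup>2 / s\<^sup>2\<close> and
  \<open>Cov(J(w - d), \<beta> \<bullet> \<nabla>J(w)) = -\<sigma>\<^sup>2 (d \<bullet> \<beta>) k(d) / s\<^sup>2\<close>.\<close>
lemma joint_iexp:
  "(CLINT \<omega>|M. iexp (t * J (w - d) \<omega> + \<alpha> * J w \<omega> + \<beta> \<bullet> field_grad w \<omega>)) =
    iexp (\<mu> * (t + \<alpha>)) * of_real (exp (- (\<sigma>\<^sup>2 * (t\<^sup>2 + \<alpha>\<^sup>2 + 2 * t * \<alpha> * se_kernel s d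
      + (norm \<beta>)\<^sup>2 / s\<^sup>2 - 2 * t * (d \<bullet> \<beta>) * se_kernel s d / s\<^sup>2)) / 2))"
proof (rule LIMSEQ_unique)
  let ?N = "\<lambda>n. real (Suc n)"
  let ?X = "\<lambda>n \<omega>. t * J (w - d) \<omega> + (\<alpha> - ?N n) * J w \<omega> + ?N n * J (w + \<beta> /\<^sub>R ?N n) \<omega>"
  show "(\<lambda>n. CLINT \<omega>|M. iexp (?X n \<omega>)) \<longlonglongrightarrow>
    (CLINT \<omega>|M. iexp (t * J (w - d) \<omega> + \<alpha> * J w \<omega> + \<beta> \<bullet> field_grad w \<omega>))"
  proof (rule integral_dominated_convergence[where w = "\<lambda>_. 1"])
    show "AE \<omega> in M. (\<lambda>n. iexp (?X n \<omega>)) \<longlonglongrightarrow> iexp (t * J (w - d) \<omega> + \<alpha> * J w \<omega> + \<beta> \<bullet> field_grad w \<omega>)"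
    proof (rule AE_I2)
      fix \<omega> assume "\<omega> \<in> space M"
      from increment_tendsto_field_grad[OF this, of w \<beta>]
      have "(\<lambda>n. t * J (w - d) \<omega> + \<alpha> * J w \<omega> + ?N n * (J (w + \<beta> /\<^sub>R ?N n) \<omega> - J w \<omega>)) \<longlonglongrightarrow>
         t * J (w - d) \<omega> + \<alpha> * J w \<omega> + \<beta> \<bullet> field_grad w \<omega>"
        by (intro tendsto_add tendsto_const)
      also have "(\<lambda>n. t * J (w - d) \<omega> + \<alpha> * J w \<omega> + ?N n * (J (w + \<beta> /\<^sub>R ?N n) \<omega> - J w \<omega>)) =
         (\<lambda>n. ?X n \<omega>)" by (simp add: algebra_simps)
      finally show "(\<lambda>n. iexp (?X n \<omega>)) \<longlonglongrightarrow> iexp (t * J (w - d) \<omega> + \<alpha> * J w \<omega> + \<beta> \<bullet> field_grad w \<omega>)"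
        by (intro tendsto_exp tendsto_mult tendsto_of_real tendsto_const)
    qed
  qed auto
  have "(CLINT \<omega>|M. iexp (?X n \<omega>)) = iexp (\<mu> * (t + \<alpha>)) * of_real (exp (- (\<sigma>\<^sup>2 *
     (t\<^sup>2 + (\<alpha> - ?N n)\<^sup>2 + (?N n)\<^sup>2 + 2 * t * (\<alpha> - ?N n) * se_kernel s d
      + 2 * t * ?N n * se_kernel s (d + \<beta> /\<^sub>R ?N n) + 2 * (\<alpha> - ?N n) * ?N n * se_kernel s (\<beta> /\<^sub>R ?N n))) / 2))"
    (is "_ = ?rhs n") for n
  proof -
    have 1: "w - d - w = - d" "w - d - (w + \<beta> /\<^sub>R ?N n) = - (d + \<beta> /\<^sub>R ?N n)"
      "w - (w + \<beta> /\<^sub>R ?N n) = - (\<beta> /\<^sub>R ?N n)" "t + (\<alpha> - ?N n) + ?N n = t + \<alpha>"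
      by auto
    show ?thesis unfolding three_point_iexp 1 se_kernel_minus ..
  qed
  moreover have "?rhs \<longlonglongrightarrow> iexp (\<mu> * (t + \<alpha>)) * of_real (exp (- (\<sigma>\<^sup>2 * (t\<^sup>2 + \<alpha>\<^sup>2 + 2 * t * \<alpha> * se_kernel s d
      + (norm \<beta>)\<^sup>2 / s\<^sup>2 - 2 * t * (d \<bullet> \<beta>) * se_kernel s d / s\<^sup>2)) / 2))"
    by (intro tendsto_mult tendsto_of_real tendsto_exp tendsto_divide tendsto_minus tendsto_const
        increment_variance_limit s) simp
  ultimately show "(\<lambda>n. CLINT \<omega>|M. iexp (?X n \<omega>)) \<longlonglongrightarrow>
    iexp (\<mu> * (t + \<alpha>)) * of_real (exp (- (\<sigma>\<^sup>2 * (t\<^sup>2 + \<alpha>\<^sup>2 + 2 * t * \<alpha> * se_kernel s d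
      + (norm \<beta>)\<^sup>2 / s\<^sup>2 - 2 * t * (d \<bullet> \<beta>) * se_kernel s d / s\<^sup>2)) / 2))"
    by (simp only:)
qed

text \<open>The length of \<open>\<beta>\<close> normalises the variance \<open>\<sigma>\<^sup>2 |\<beta>|\<^sup>2 / s\<^sup>2\<close> to \<open>1\<close>. This law provides both the
  integrability of the gradient and its being nonzero almost surely.\<close>
lemma directional_derivative_std_normal:
  assumes "norm \<beta> = s / \<bar>\<sigma>\<bar>"
  shows "distributed M lborel (\<lambda>\<omega>. \<beta> \<bullet> field_grad w \<omega>) std_normal_density"
proof (rule std_normal_of_iexp)
  show "(CLINT \<omega>|M. iexp (t * (\<beta> \<bullet> field_grad w \<omega>))) = of_real (exp (- (t\<^sup>2) / 2))" for t
  proof -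
    have "\<sigma>\<^sup>2 * ((norm (t *\<^sub>R \<beta>))\<^sup>2 / s\<^sup>2) = t\<^sup>2"
      using assms s sigma by (simp add: power_mult_distrib power_divide)
    then show ?thesis using joint_iexp[of 0 w 0 0 "t *\<^sub>R \<beta>"] by simp
  qed
qed measurable

lemma inner_field_grad_integrable: "integrable M (\<lambda>\<omega>. \<beta> \<bullet> field_grad w \<omega>)"
proof (cases "\<beta> = 0")
  case False
  define c where "c = (s / \<bar>\<sigma>\<bar>) / norm \<beta>"
  have c: "c > 0" using False s sigma by (simp add: c_def)
  then have "norm (c *\<^sub>R \<beta>) = s / \<bar>\<sigma>\<bar>" using False s by (simp add: c_def)
  from directional_derivative_std_normal[OF this, of w]
  have "integrable M (\<lambda>\<omega>. (c *\<^sub>R \<beta>) \<bullet> field_grad w \<omega>)"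
    using distributed_integrable[of M lborel "\<lambda>\<omega>. (c *\<^sub>R \<beta>) \<bullet> field_grad w \<omega>" std_normal_density "\<lambda>x. x"]
      integrable_std_normal_moment[of 1] by simp
  then have "integrable M (\<lambda>\<omega>. (1 / c) * ((c *\<^sub>R \<beta>) \<bullet> field_grad w \<omega>))" by (rule integrable_mult_right)
  then show ?thesis using c by simp
qed simp

lemma field_grad_nonzero: "AE \<omega> in M. field_grad w \<omega> \<noteq> 0"
proof -
  obtain b :: 'a where b: "b \<in> Basis" using nonempty_Basis by blast
  define \<beta> where "\<beta> = (s / \<bar>\<sigma>\<bar>) *\<^sub>R b"
  have "norm \<beta> = s / \<bar>\<sigma>\<bar>" using b s by (simp add: \<beta>_def)
  note D = directional_derivative_std_normal[OF this, of w]
  have "AE x in density lborel std_normal_density. x \<noteq> 0"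
    by (subst AE_density) (use AE_lborel_singleton[of "0::real"] in auto)
  then have "AE x in distr M lborel (\<lambda>\<omega>. \<beta> \<bullet> field_grad w \<omega>). x \<noteq> 0"
    unfolding distributed_distr_eq_density[OF D] .
  then have "AE \<omega> in M. \<beta> \<bullet> field_grad w \<omega> \<noteq> 0" by (subst (asm) AE_distr_iff) auto
  then show ?thesis by eventually_elim auto
qed

section \<open>The conditional expectation\<close>

text \<open>The linear regression of \<open>J(w - d)\<close> on \<open>J(w)\<close> and the gradient: these are uncorrelated, so each
  coefficient is a covariance from \<open>joint_iexp\<close> divided by the variance of its regressor.\<close>
definition predictor :: "'a \<Rightarrow> 'a \<Rightarrow> 'w \<Rightarrow> real" where
  "predictor w d \<omega> = \<mu> + se_kernel s d * (J w \<omega> - \<mu> - d \<bullet> field_grad w \<omega>)"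

lemma predictor_integrable: "integrable M (predictor w d)"
  unfolding predictor_def using J_integrable inner_field_grad_integrable by auto

text \<open>Substituting the predictor into \<open>joint_iexp\<close>, all terms of the exponent that are linear in \<open>t\<close>
  cancel: the residual is centred and uncorrelated with the observation.\<close>
lemma residual_iexp:
  "(CLINT \<omega>|M. iexp (t * (J (w - d) \<omega> - predictor w d \<omega>) + (\<alpha> * J w \<omega> + \<beta> \<bullet> field_grad w \<omega>))) =
    iexp (\<mu> * \<alpha>) * of_real (exp (- (\<sigma>\<^sup>2 * (\<alpha>\<^sup>2 + (norm \<beta>)\<^sup>2 / s\<^sup>2)) / 2)) *
      of_real (exp (- (\<sigma>\<^sup>2 * (1 - (se_kernel s d)\<^sup>2 * (1 + (norm d)\<^sup>2 / s\<^sup>2))) / 2 * t\<^sup>2))"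
proof -
  define k where "k = se_kernel s d"
  let ?X = "\<lambda>\<omega>. t * J (w - d) \<omega> + (\<alpha> - t * k) * J w \<omega> + (\<beta> + (t * k) *\<^sub>R d) \<bullet> field_grad w \<omega>"
  have X: "t * (J (w - d) \<omega> - predictor w d \<omega>) + (\<alpha> * J w \<omega> + \<beta> \<bullet> field_grad w \<omega>) =
      - (t * \<mu> * (1 - k)) + ?X \<omega>" for \<omega>
    by (simp add: predictor_def k_def[symmetric] inner_add_left algebra_simps)
  have m: "- (t * \<mu> * (1 - k)) + \<mu> * (t + (\<alpha> - t * k)) = \<mu> * \<alpha>" by (simp add: algebra_simps)
  have nb: "(norm (\<beta> + (t * k) *\<^sub>R d))\<^sup>2 = (norm \<beta>)\<^sup>2 + 2 * t * k * (d \<bullet> \<beta>) + t\<^sup>2 * k\<^sup>2 * (norm d)\<^sup>2"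
    unfolding power2_norm_eq_inner
    by (simp add: inner_add_left inner_add_right inner_commute power2_eq_square algebra_simps)
  have db: "d \<bullet> (\<beta> + (t * k) *\<^sub>R d) = d \<bullet> \<beta> + t * k * (norm d)\<^sup>2"
    by (simp add: inner_add_right power2_norm_eq_inner)
  have v: "t\<^sup>2 + (\<alpha> - t * k)\<^sup>2 + 2 * t * (\<alpha> - t * k) * k
      + (norm (\<beta> + (t * k) *\<^sub>R d))\<^sup>2 / s\<^sup>2 - 2 * t * (d \<bullet> (\<beta> + (t * k) *\<^sub>R d)) * k / s\<^sup>2 =
      \<alpha>\<^sup>2 + (norm \<beta>)\<^sup>2 / s\<^sup>2 + (1 - k\<^sup>2 * (1 + (norm d)\<^sup>2 / s\<^sup>2)) * t\<^sup>2"
    unfolding nb db using s by (simp add: field_simps power2_eq_square)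
  have "(CLINT \<omega>|M. iexp (- (t * \<mu> * (1 - k)) + ?X \<omega>)) = iexp (- (t * \<mu> * (1 - k))) * (CLINT \<omega>|M. iexp (?X \<omega>))"
    by (simp only: of_real_add distrib_left exp_add integral_mult_right_zero)
  also have "\<dots> = iexp (- (t * \<mu> * (1 - k)) + \<mu> * (t + (\<alpha> - t * k))) * of_real (exp (- (\<sigma>\<^sup>2 *
      (\<alpha>\<^sup>2 + (norm \<beta>)\<^sup>2 / s\<^sup>2 + (1 - k\<^sup>2 * (1 + (norm d)\<^sup>2 / s\<^sup>2)) * t\<^sup>2)) / 2))"
    unfolding joint_iexp k_def[symmetric] v by (simp only: of_real_add distrib_left exp_add mult.assoc)
  finally have F: "(CLINT \<omega>|M. iexp (- (t * \<mu> * (1 - k)) + ?X \<omega>)) = \<dots>" .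
  have e: "exp (- (\<sigma>\<^sup>2 * (A + B * t\<^sup>2)) / 2) = exp (- (\<sigma>\<^sup>2 * A) / 2) * exp (- (\<sigma>\<^sup>2 * B) / 2 * t\<^sup>2)" for A B
    unfolding mult_exp_exp by (rule arg_cong[where f = exp]) (simp add: field_simps)
  show ?thesis unfolding X F m k_def[symmetric] e by (simp only: of_real_mult mult.assoc)
qed

text \<open>By \<open>residual_iexp\<close>, \<open>E[exp(i t R + i V)]\<close> depends on \<open>t\<close> only through \<open>exp(c t\<^sup>2)\<close>, so its
  derivative at \<open>t = 0\<close> vanishes; that derivative is \<open>i E[R exp(i V)]\<close>, with the difference
  quotients dominated by \<open>|R|\<close>.\<close>
lemma residual_fourier:
  "(CLINT \<omega>|M. of_real (J (w - d) \<omega> - predictor w d \<omega>) * iexp (\<alpha> * J w \<omega> + \<beta> \<bullet> field_grad w \<omega>)) = 0"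
proof -
  define R where "R \<omega> = J (w - d) \<omega> - predictor w d \<omega>" for \<omega>
  define V where "V \<omega> = \<alpha> * J w \<omega> + \<beta> \<bullet> field_grad w \<omega>" for \<omega>
  have R: "integrable M R"
    unfolding R_def by (intro Bochner_Integration.integrable_diff J_integrable predictor_integrable)
  have [measurable]: "R \<in> borel_measurable M" using R by auto
  have [measurable]: "V \<in> borel_measurable M" unfolding V_def by measurable
  define h where "h n = inverse (real (Suc n))" for n
  have h0: "h n > 0" for n by (simp add: h_def)
  have hlim: "h \<longlonglongrightarrow> 0" unfolding h_def by (rule LIMSEQ_inverse_real_of_nat)
  let ?q = "\<lambda>n \<omega>. (iexp (h n * R \<omega>) - 1) / h n * iexp (V \<omega>)"
  have "(\<lambda>n. CLINT \<omega>|M. ?q n \<omega>) \<longlonglongrightarrow> (CLINT \<omega>|M. \<i> * of_real (R \<omega>) * iexp (V \<omega>))"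
  proof (rule integral_dominated_convergence[where w = "\<lambda>\<omega>. \<bar>R \<omega>\<bar>"])
    show "AE \<omega> in M. (\<lambda>n. ?q n \<omega>) \<longlonglongrightarrow> \<i> * of_real (R \<omega>) * iexp (V \<omega>)"
    proof (rule AE_I2)
      fix \<omega>
      define f where "f z = exp (z * (\<i> * of_real (R \<omega>)))" for z :: complex
      have "(f has_field_derivative \<i> * of_real (R \<omega>)) (at 0)"
        unfolding f_def by (auto intro!: derivative_eq_intros)
      moreover have "(\<lambda>n. complex_of_real (h n)) \<longlonglongrightarrow> 0"
        using tendsto_of_real[OF hlim, where 'a = complex] by simp
      ultimately have "(\<lambda>n. (f (of_real (h n)) - f 0) / of_real (h n)) \<longlonglongrightarrow> \<i> * of_real (R \<omega>)"
        using h0 by (intro difference_quotient_sequentially) (auto simp: less_imp_neq[symmetric])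
      from tendsto_mult_right[OF this, of "iexp (V \<omega>)"]
      show "(\<lambda>n. ?q n \<omega>) \<longlonglongrightarrow> \<i> * of_real (R \<omega>) * iexp (V \<omega>)"
        by (simp add: f_def mult_ac)
    qed
    show "AE \<omega> in M. norm (?q n \<omega>) \<le> \<bar>R \<omega>\<bar>" for n
    proof (rule AE_I2)
      fix \<omega>
      have "norm (iexp (h n * R \<omega>) - 1) \<le> \<bar>h n * R \<omega>\<bar>"
        using iexp_approx1[of "h n * R \<omega>" 0] by simp
      then have "norm ((iexp (h n * R \<omega>) - 1) / of_real (h n)) \<le> \<bar>R \<omega>\<bar>"
        using h0[of n] by (simp add: norm_divide abs_mult pos_divide_le_eq mult.commute)
      then show "norm (?q n \<omega>) \<le> \<bar>R \<omega>\<bar>"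
        unfolding norm_mult by (simp del: of_real_mult)
    qed
  qed (use R in auto)
  moreover have "(\<lambda>n. CLINT \<omega>|M. ?q n \<omega>) \<longlonglongrightarrow> 0"
  proof -
    define c where "c = - (\<sigma>\<^sup>2 * (1 - (se_kernel s d)\<^sup>2 * (1 + (norm d)\<^sup>2 / s\<^sup>2))) / 2"
    define A where "A = iexp (\<mu> * \<alpha>) * of_real (exp (- (\<sigma>\<^sup>2 * (\<alpha>\<^sup>2 + (norm \<beta>)\<^sup>2 / s\<^sup>2)) / 2))"
    have E: "(CLINT \<omega>|M. iexp (t * R \<omega> + V \<omega>)) = A * of_real (exp (c * t\<^sup>2))" for t
      unfolding R_def V_def A_def c_def by (rule residual_iexp)
    have q: "(CLINT \<omega>|M. ?q n \<omega>) = A * of_real ((exp (c * (h n)\<^sup>2) - exp (c * 0\<^sup>2)) / h n)" for n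
    proof -
      have int: "integrable M (\<lambda>\<omega>. iexp (t * R \<omega> + V \<omega>))" for t
        by (rule integrable_iexp) auto
      have "?q n \<omega> = (iexp (h n * R \<omega> + V \<omega>) - iexp (0 * R \<omega> + V \<omega>)) / h n" for \<omega>
        by (simp add: distrib_left exp_add left_diff_distrib diff_divide_distrib)
      then have "(CLINT \<omega>|M. ?q n \<omega>) =
          (CLINT \<omega>|M. (iexp (h n * R \<omega> + V \<omega>) - iexp (0 * R \<omega> + V \<omega>)) / h n)"
        by (simp only:)
      also have "\<dots> = ((CLINT \<omega>|M. iexp (h n * R \<omega> + V \<omega>)) - (CLINT \<omega>|M. iexp (0 * R \<omega> + V \<omega>))) / h n"
        using int[of "h n"] int[of 0]
        by (simp only: integral_divide_zero Bochner_Integration.integral_diff)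
      also have "\<dots> = A * of_real ((exp (c * (h n)\<^sup>2) - exp (c * 0\<^sup>2)) / h n)"
        unfolding E by (simp add: right_diff_distrib)
      finally show ?thesis .
    qed
    have "((\<lambda>x. exp (c * x\<^sup>2)) has_field_derivative 0) (at 0)"
      by (auto intro!: derivative_eq_intros)
    from difference_quotient_sequentially[OF this hlim] h0
    have "(\<lambda>n. (exp (c * (h n)\<^sup>2) - exp (c * 0\<^sup>2)) / h n) \<longlonglongrightarrow> 0" 
      by (simp add: less_imp_neq[symmetric])
    from tendsto_mult_left[OF tendsto_of_real[OF this], of A] show ?thesis unfolding q by simp
  qed
  ultimately have "(CLINT \<omega>|M. \<i> * of_real (R \<omega>) * iexp (V \<omega>)) = 0" by (rule LIMSEQ_unique)
  then have "\<i> * (CLINT \<omega>|M. of_real (R \<omega>) * iexp (V \<omega>)) = 0"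
    by (simp only: mult.assoc integral_mult_right_zero)
  then show ?thesis by (simp add: R_def V_def)
qed

lemma predictor_cond_exp:
  "predictor w d \<in> borel_measurable (value_grad_algebra M J w)"
  "AE \<omega> in M. real_cond_exp M (value_grad_algebra M J w) (J (w - d)) \<omega> = predictor w d \<omega>"
proof -
  define Y where "Y \<omega> = (J w \<omega>, field_grad w \<omega>)" for \<omega>
  have Y [measurable]: "Y \<in> borel_measurable M"
    unfolding Y_def by (intro borel_measurable_Pair) measurable
  let ?F = "value_grad_algebra M J w"
  have F: "?F = vimage_algebra (space M) Y borel"
    unfolding value_grad_algebra_def Y_def field_grad_def ..
  have sets_F: "sets ?F = {Y -` S \<inter> space M | S. S \<in> sets borel}"
    unfolding F by (rule sets_vimage_algebra2) auto
  have sub: "subalgebra M ?F"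
    unfolding subalgebra_def sets_F by (auto simp: F intro: measurable_sets[OF Y])
  interpret F: finite_measure_subalgebra M ?F by standard (rule sub)
  have YF: "Y \<in> borel_measurable ?F" unfolding F by (rule measurable_vimage_algebra1) auto
  have "(\<lambda>\<omega>. fst (Y \<omega>)) \<in> borel_measurable ?F" "(\<lambda>\<omega>. snd (Y \<omega>)) \<in> borel_measurable ?F"
    using measurable_compose[OF YF[unfolded borel_prod[symmetric]] measurable_fst]
      measurable_compose[OF YF[unfolded borel_prod[symmetric]] measurable_snd] by auto
  then have [measurable]: "J w \<in> borel_measurable ?F" "field_grad w \<in> borel_measurable ?F"
    by (simp_all add: Y_def)
  show P: "predictor w d \<in> borel_measurable ?F" unfolding predictor_def by measurable
  show "AE \<omega> in M. real_cond_exp M ?F (J (w - d)) \<omega> = predictor w d \<omega>"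
  proof (rule F.real_cond_exp_charact)
    fix A assume "A \<in> sets ?F"
    then obtain S where S: "S \<in> sets borel" and A: "A = Y -` S \<inter> space M" unfolding sets_F by auto
    have AM: "A \<in> sets M" unfolding A by (rule measurable_sets[OF Y S])
    have "(LINT \<omega>|M. (J (w - d) \<omega> - predictor w d \<omega>) * indicator S (Y \<omega>)) = 0"
    proof (rule fourier_uniqueness[OF _ Y _ S])
      show "integrable M (\<lambda>\<omega>. J (w - d) \<omega> - predictor w d \<omega>)"
        by (intro Bochner_Integration.integrable_diff J_integrable predictor_integrable)
      show "(CLINT \<omega>|M. of_real (J (w - d) \<omega> - predictor w d \<omega>) * iexp (u \<bullet> Y \<omega>)) = 0" for u
        using residual_fourier[of w d "fst u" "snd u"] by (simp add: Y_def inner_prod_def)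
    qed
    moreover have "(LINT \<omega>|M. (J (w - d) \<omega> - predictor w d \<omega>) * indicator S (Y \<omega>)) =
        (LINT \<omega>:A|M. J (w - d) \<omega> - predictor w d \<omega>)"
      unfolding set_lebesgue_integral_def A
      by (rule Bochner_Integration.integral_cong) (auto simp: indicator_def)
    moreover have "\<dots> = (LINT \<omega>:A|M. J (w - d) \<omega>) - (LINT \<omega>:A|M. predictor w d \<omega>)"
      by (intro set_integral_diff; unfold set_integrable_def)
        (rule integrable_mult_indicator[OF AM] J_integrable predictor_integrable)+
    ultimately show "(LINT \<omega>:A|M. J (w - d) \<omega>) = (LINT \<omega>:A|M. predictor w d \<omega>)" by simp
  qed (rule J_integrable predictor_integrable P)+
qed

lemma predictor_continuous: "continuous_on UNIV (\<lambda>d. predictor w d \<omega>)"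
  unfolding predictor_def se_kernel_def using s by (intro continuous_intros) auto

lemma predictor_version:
  "continuous_cond_exp_version M (value_grad_algebra M J w) (\<lambda>d. J (w - d)) (predictor w)"
  unfolding continuous_cond_exp_version_def
  using predictor_cond_exp[of w] predictor_continuous by (auto intro: AE_symmetric)

lemma argmin_predictor:
  assumes "field_grad w \<omega> \<noteq> 0"
  shows "argmin_set (\<lambda>d. predictor w d \<omega>) =
    {rfd_step_size \<mu> s (J w \<omega>) (field_grad w \<omega>) *\<^sub>R (field_grad w \<omega> /\<^sub>R norm (field_grad w \<omega>))}"
  unfolding predictor_def se_kernel_def by (rule argmin_affine_times_gaussian[OF s assms])

end

text \<open>For each \<open>d\<close> separately the versions agree outside a null set depending on \<open>d\<close>; countably many of these
  null sets suffice because two continuous functions that agree on a dense set are equal.\<close>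
lemma continuous_cond_exp_version_unique:
  fixes Z Z' :: "'a::euclidean_space \<Rightarrow> 'w \<Rightarrow> real"
  assumes "continuous_cond_exp_version M F X Z" "continuous_cond_exp_version M F X Z'"
  shows "AE \<omega> in M. \<forall>d. Z d \<omega> = Z' d \<omega>"
proof -
  obtain D :: "'a set" where D: "countable D" "\<And>U. open U \<Longrightarrow> U \<noteq> {} \<Longrightarrow> \<exists>d\<in>D. d \<in> U"
    by (rule countable_dense_setE) blast
  then have dense: "closure D = UNIV" 
    by (intro set_eqI) (metis UNIV_I closure_iff_nhds_not_empty disjoint_iff empty_iff subsetD)
  have "AE \<omega> in M. \<forall>d\<in>D. Z d \<omega> = Z' d \<omega>"
  proof (subst AE_ball_countable[OF D(1)], rule ballI)
    fix d
    have "AE \<omega> in M. Z d \<omega> = real_cond_exp M F (X d) \<omega>" "AE \<omega> in M. Z' d \<omega> = real_cond_exp M F (X d) \<omega>"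
      using assms by (auto simp: continuous_cond_exp_version_def)
    then show "AE \<omega> in M. Z d \<omega> = Z' d \<omega>" by eventually_elim simp
  qed
  moreover have "AE \<omega> in M. continuous_on UNIV (\<lambda>d. Z d \<omega>)" "AE \<omega> in M. continuous_on UNIV (\<lambda>d. Z' d \<omega>)"
    using assms by (auto simp: continuous_cond_exp_version_def)
  ultimately show ?thesis
  proof eventually_elim
    case (elim \<omega>)
    have "closed {d. Z d \<omega> = Z' d \<omega>}" using elim(2,3) by (rule closed_Collect_eq)
    then have "closure D \<subseteq> {d. Z d \<omega> = Z' d \<omega>}" using elim(1) by (intro closure_minimal) auto
    then show ?case using dense by auto
  qed
qed

theorem theoremC1:
  fixes M :: "'w measure"
    and J :: "real ^ 'n \<Rightarrow> 'w \<Rightarrow> real"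
    and C :: "real \<Rightarrow> real"
    and \<mu> \<sigma> s :: real
    and w :: "real ^ 'n"
  assumes J: "isotropic_gaussian_function M J \<mu> C"
    and C: "\<And>x y :: real ^ 'n.
              C ((norm (x - y))\<^sup>2 / 2) = \<sigma>\<^sup>2 * exp (- ((norm (x - y))\<^sup>2 / (2 * s\<^sup>2)))"
    and sigma: "\<sigma>\<^sup>2 > 0"
    and s: "s > 0"
  shows "(\<exists>Z. continuous_cond_exp_version M (value_grad_algebra M J w) (\<lambda>d. J (w - d)) Z) \<and>
         (\<forall>Z. continuous_cond_exp_version M (value_grad_algebra M J w) (\<lambda>d. J (w - d)) Z \<longrightarrow>
           (AE \<omega> in M.
              (let g = grad (\<lambda>x. J x \<omega>) w in
                 g \<noteq> 0 \<and>
                 argmin_set (\<lambda>d. Z d \<omega>) = {rfd_step_size \<mu> s (J w \<omega>) g *\<^sub>R (g /\<^sub>R norm g)})))"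
proof -
  interpret prob_space M using J by (simp add: isotropic_gaussian_function_def)
  interpret se_gaussian_field M J \<mu> \<sigma> s
    by unfold_locales
      (use J C sigma s in \<open>auto simp: isotropic_gaussian_function_def se_kernel_def\<close>)
  show ?thesis
  proof (intro conjI allI impI)
    show "\<exists>Z. continuous_cond_exp_version M (value_grad_algebra M J w) (\<lambda>d. J (w - d)) Z"
      using predictor_version by blast
    fix Z assume Z: "continuous_cond_exp_version M (value_grad_algebra M J w) (\<lambda>d. J (w - d)) Z"
    from continuous_cond_exp_version_unique[OF Z predictor_version] field_grad_nonzero[of w]
    show "AE \<omega> in M. (let g = grad (\<lambda>x. J x \<omega>) w in g \<noteq> 0 \<and>
        argmin_set (\<lambda>d. Z d \<omega>) = {rfd_step_size \<mu> s (J w \<omega>) g *\<^sub>R (g /\<^sub>R norm g)})"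
    proof eventually_elim
      case (elim \<omega>)
      then have "(\<lambda>d. Z d \<omega>) = (\<lambda>d. predictor w d \<omega>)" by auto
      then show ?case using argmin_predictor[OF elim(2)] elim(2) by (simp add: field_grad_def Let_def)
    qed
  qed
qed

end
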